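(* For all $s,t>0$ and all $\zeta\in\mathbb U$, there exists a unique probability measure $k_{s,t}(\zeta,d\omega)$ on $\mathbb U$ characterized by the moment-generating function $$\int_{\mathbb U}\frac{z\omega}{1-z\omega}\,k_{s,t}(\zeta,d\omega)=\frac{\chi_{s,t}(z)\zeta}{1-\chi_{s,t}(z)\zeta},\qquad z\in\mathbb D.$$ If $s=t$, then $k_{s,t}(\zeta,d\omega)=k_s(\zeta,d\omega)$.
   Context: $\mathbb U$ is the unit circle, $\mathbb D$ the open unit disk. For $r\in\mathbb R$ let $f_r(z)=z\exp\big(\frac r2\frac{1+z}{1-z}\big)$. For $s>0$ let $\Omega_s=\{z\in\mathbb D:f_s(z)\in\mathbb D\}$; $f_s$ maps $\Omega_s$ conformally onto $\mathbb D$, and $\chi_s:\mathbb D\to\Omega_s$ denotes the inverse. Put $\chi_{s,t}=f_{s-t}\circ\chi_s$ on $\mathbb D$ for $s,t>0$. $k_s(\zeta,d\omega)$ denotes Biane's kernel: the probability measure on $\mathbb U$ with $\int_{\mathbb U}\frac{z\omega}{1-z\omega}k_s(\zeta,d\omega)=\frac{\chi_s(z)\zeta}{1-\chi_s(z)\zeta}$ for $z\in\mathbb D$. *)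

theory Defs
  imports "HOL-Probability.Probability"
begin

definition biane_f :: "real \<Rightarrow> complex \<Rightarrow> complex" where
  "biane_f r z = z * exp (complex_of_real (r / 2) * ((1 + z) / (1 - z)))"

definition biane_Omega :: "real \<Rightarrow> complex set" where
  "biane_Omega s = {z \<in> ball 0 1. biane_f s z \<in> ball 0 1}"

text \<open>For \<open>s > 0\<close> the map \<open>biane_f s\<close> is a bijection of \<open>biane_Omega s\<close> onto the unit disk, with inverse
  \<open>chi s\<close>; the values of \<open>chi s\<close> and \<open>chi2 s t\<close> are meaningful on the unit disk only.\<close>

definition chi :: "real \<Rightarrow> complex \<Rightarrow> complex" where
  "chi s = the_inv_into (biane_Omega s) (biane_f s)"

definition chi2 :: "real \<Rightarrow> real \<Rightarrow> complex \<Rightarrow> complex" where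
  "chi2 s t z = biane_f (s - t) (chi s z)"

definition circle_borel :: "complex measure" where
  "circle_borel = restrict_space borel (sphere 0 1)"

definition circle_prob :: "complex measure \<Rightarrow> bool" where
  "circle_prob \<mu> \<longleftrightarrow> prob_space \<mu> \<and> sets \<mu> = sets circle_borel"

text \<open>The two kernels are given by definite descriptions, at a point \<open>\<zeta>\<close> of the unit circle.
  For a Borel probability measure on the circle all integrands below are bounded and continuous,
  hence integrable.\<close>

definition biane_kernel :: "real \<Rightarrow> complex \<Rightarrow> complex measure" where
  "biane_kernel s \<zeta> = (THE \<mu>. circle_prob \<mu> \<and>
     (\<forall>z\<in>ball 0 1. (\<integral>\<omega>. z * \<omega> / (1 - z * \<omega>) \<partial>\<mu>) = chi s z * \<zeta> / (1 - chi s z * \<zeta>)))"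

definition kernel2 :: "real \<Rightarrow> real \<Rightarrow> complex \<Rightarrow> complex measure" where
  "kernel2 s t \<zeta> = (THE \<mu>. circle_prob \<mu> \<and>
     (\<forall>z\<in>ball 0 1. (\<integral>\<omega>. z * \<omega> / (1 - z * \<omega>) \<partial>\<mu>) = chi2 s t z * \<zeta> / (1 - chi2 s t z * \<zeta>)))"

end

theory Submission
  imports Defs "HOL-Complex_Analysis.Complex_Analysis"
begin

text \<open>Since \<open>norm (biane_f r w)\<close> increases with \<open>r\<close> on the disc, \<open>h = chi2 s t\<close> is a holomorphic
  self-map of the disc fixing \<open>0\<close>. Hence \<open>(1 + h \<zeta>) / (1 - h \<zeta>)\<close> has positive real part and value
  \<open>1\<close> at \<open>0\<close>, and the measure is its Herglotz measure: a weak limit of the densities given by the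
  real part on circles of radius \<open>r < 1\<close>. Uniqueness holds because the Taylor coefficients of the
  generating function are the moments, and these determine a measure on the circle.\<close>

subsection \<open>The conformal map and its inverse\<close>

text \<open>Multiplying by the conjugate of the denominator turns the real part into the Poisson
  kernel (1 - |z|^2) / |1 - z|^2. It serves twice: for the growth of |\<open>biane_f r z\<close>| in
  \<open>r\<close> and for the positivity that Herglotz measures require.\<close>

lemma Re_cayley_pos:
  fixes z :: complex
  assumes "norm z < 1"
  shows "Re ((1 + z) / (1 - z)) > 0"
proof -
  have nz: "1 - z \<noteq> 0"
    using assms by auto
  have "(1 + z) / (1 - z) = (1 + z) * cnj (1 - z) / of_real ((norm (1 - z))\<^sup>2)"
    unfolding complex_norm_square using nz
    by (intro nonzero_mult_divide_mult_cancel_right[symmetric]) simp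
  moreover have "Re ((1 + z) * cnj (1 - z)) = 1 - (norm z)\<^sup>2"
    unfolding cmod_power2 by (simp add: algebra_simps power2_eq_square)
  ultimately have "Re ((1 + z) / (1 - z)) = (1 - (norm z)\<^sup>2) / (norm (1 - z))\<^sup>2"
    by (metis Re_divide_of_real)
  moreover have "(norm z)\<^sup>2 < 1"
    using assms by (simp add: power_less_one_iff)
  ultimately show ?thesis
    using nz by simp
qed

text \<open>Conjugation by a disc automorphism moves the fixed point \<open>a\<close> to 0. The
  other fixed point then gives equality in the Schwarz lemma, so the conjugated map is linear, with
  factor 1.\<close>

lemma fixpoints_disc_imp_id:
  assumes holg: "g holomorphic_on ball 0 1" and gim: "g ` ball 0 1 \<subseteq> ball 0 1"
    and a: "a \<in> ball 0 1" "g a = a" and b: "b \<in> ball 0 1" "g b = b" and "a \<noteq> b"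
    and z: "z \<in> ball 0 1"
  shows "g z = z"
proof -
  obtain \<phi> \<psi> where \<phi>a: "\<phi> a = 0"
    and hol\<phi>: "\<phi> holomorphic_on ball 0 1" and \<phi>im: "\<phi> ` ball 0 1 \<subseteq> ball 0 1"
    and hol\<psi>: "\<psi> holomorphic_on ball 0 1" and \<psi>im: "\<psi> ` ball 0 1 \<subseteq> ball 0 1"
    and \<phi>\<psi>: "\<And>z. z \<in> ball 0 1 \<Longrightarrow> \<phi> (\<psi> z) = z"
    and \<psi>\<phi>: "\<And>z. z \<in> ball 0 1 \<Longrightarrow> \<psi> (\<phi> z) = z"
    using ball_biholomorphism_exists[OF a(1)] by metis
  define F where "F = \<phi> \<circ> (g \<circ> \<psi>)"
  have holF: "F holomorphic_on ball 0 1"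
    unfolding F_def
    by (intro holomorphic_on_compose_gen[OF _ hol\<phi>] holomorphic_on_compose_gen[OF hol\<psi> holg])
       (use \<psi>im gim in \<open>auto simp: image_subset_iff\<close>)
  have F\<phi>: "F (\<phi> w) = \<phi> (g w)" if "w \<in> ball 0 1" for w
    using \<psi>\<phi>[OF that] by (simp add: F_def)
  have F0: "F 0 = 0"
    using F\<phi>[OF a(1)] a(2) \<phi>a by simp
  have Fim: "norm (F w) < 1" if "norm w < 1" for w
    using \<phi>im gim \<psi>im that by (auto simp: F_def image_subset_iff)
  have Fb: "F (\<phi> b) = \<phi> b"
    using F\<phi>[OF b(1)] b(2) by simp
  have \<phi>b: "\<phi> b \<noteq> 0" "norm (\<phi> b) < 1"
    using \<psi>\<phi>[OF a(1)] \<psi>\<phi>[OF b(1)] \<open>a \<noteq> b\<close> \<phi>a \<phi>im b(1) by (auto simp: image_subset_iff)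
  \<comment> \<open>Equality |F u| = |u| is attained at the nonzero point u =
    \<open>\<phi> b\<close>.\<close>
  obtain \<alpha> where \<alpha>: "\<And>w. norm w < 1 \<Longrightarrow> F w = \<alpha> * w"
    using Schwarz_Lemma(3)[OF holF F0 Fim, of 0] \<phi>b Fb by (metis norm_zero zero_less_one)
  have "\<alpha> = 1"
    using \<alpha>[OF \<phi>b(2)] Fb \<phi>b(1) by simp
  moreover have "norm (\<phi> z) < 1"
    using \<phi>im z by (auto simp: image_subset_iff)
  ultimately have "\<phi> (g z) = \<phi> z"
    using \<alpha>[of "\<phi> z"] F\<phi>[OF z] by simp
  moreover have "g z \<in> ball 0 1"
    using gim z by blast
  ultimately show ?thesis
    using \<psi>\<phi> z by metis
qed

section \<open>The maps \<open>biane_f r\<close> on the disc\<close>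

lemma biane_f_0 [simp]: "biane_f r 0 = 0"
  by (simp add: biane_f_def)

lemma norm_biane_f:
  "norm (biane_f r z) = norm z * exp (r / 2 * Re ((1 + z) / (1 - z)))"
proof -
  have "Re (complex_of_real (r / 2) * ((1 + z) / (1 - z))) = r / 2 * Re ((1 + z) / (1 - z))"
    by (simp only: scaleR_conv_of_real[symmetric] scaleR_complex.sel)
  then show ?thesis
    by (simp add: biane_f_def norm_mult)
qed

text \<open>By \<open>Re_cayley_pos\<close>, the exponent in \<open>norm_biane_f\<close> is
  increasing in \<open>r\<close>. Applied to s - t and s, this keeps the values of
  \<open>chi2\<close> inside the disc.\<close>

lemma norm_biane_f_mono:
  assumes "r \<le> s" "norm z < 1"
  shows "norm (biane_f r z) \<le> norm (biane_f s z)"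
proof -
  have "r / 2 * Re ((1 + z) / (1 - z)) \<le> s / 2 * Re ((1 + z) / (1 - z))"
    by (rule mult_right_mono) (use assms(1) less_imp_le[OF Re_cayley_pos[OF assms(2)]] in auto)
  then show ?thesis
    unfolding norm_biane_f by (intro mult_left_mono) (simp_all only: exp_le_cancel_iff norm_ge_zero)
qed

lemma holomorphic_biane_f: "biane_f r holomorphic_on ball 0 1"
proof -
  have "1 - z \<noteq> 0" if "z \<in> ball 0 1" for z :: complex
    using that by auto
  then show ?thesis
    unfolding biane_f_def by (intro holomorphic_intros) auto
qed

lemma open_biane_Omega: "open (biane_Omega s)"
proof -
  have "biane_Omega s = ball 0 1 \<inter> biane_f s -` ball 0 1"
    by (auto simp: biane_Omega_def)
  then show ?thesis
    using holomorphic_on_imp_continuous_on[OF holomorphic_biane_f]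
    by (metis open_ball continuous_open_preimage)
qed

text \<open>Solutions \<open>w\<close> of \<open>biane_f s w = z\<close> are the fixed points of a holomorphic map of the disc
  into the disc of radius \<open>norm z\<close>: Brouwer's theorem yields one, and the Schwarz lemma at most one.\<close>

lemma bij_betw_biane_f:
  assumes "s \<ge> 0"
  shows "bij_betw (biane_f s) (biane_Omega s) (ball 0 1)"
proof -
  \<comment> \<open>Solving \<open>biane_f s w = z\<close> for the leading factor w gives w =
    \<open>g z w\<close>. For s >= 0 the exponent has nonpositive real part, so
    |\<open>g z w\<close>| <= |z|.\<close>
  define g where "g z w = z * exp (- (complex_of_real (s / 2) * ((1 + w) / (1 - w))))"
    for z w :: complex
  have fix_iff: "g z w = w \<longleftrightarrow> biane_f s w = z" for z w
  proof -
    have "z * inverse c = w \<longleftrightarrow> w * c = z" if "c \<noteq> 0" for c :: complex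
      using that by (auto simp: field_simps)
    then show ?thesis
      unfolding g_def biane_f_def exp_minus using exp_not_eq_zero by blast
  qed
  have g_le: "norm (g z w) \<le> norm z" if "norm w < 1" for z w
  proof -
    have "Re (complex_of_real (s / 2) * ((1 + w) / (1 - w))) = s / 2 * Re ((1 + w) / (1 - w))"
      by (simp only: scaleR_conv_of_real[symmetric] scaleR_complex.sel)
    also have "\<dots> \<ge> 0"
      by (rule mult_nonneg_nonneg) (use assms less_imp_le[OF Re_cayley_pos[OF that]] in auto)
    finally show ?thesis
      unfolding g_def norm_mult norm_exp_eq_Re uminus_complex.sel
      by (intro mult_left_le) simp_all
  qed
  have holg: "g z holomorphic_on ball 0 1" for z
  proof -
    have "1 - w \<noteq> 0" if "w \<in> ball 0 1" for w :: complex
      using that by auto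
    then show ?thesis
      unfolding g_def by (intro holomorphic_intros) auto
  qed
  have "inj_on (biane_f s) (biane_Omega s)"
  proof (rule inj_onI, rule ccontr)
    fix a b
    assume a: "a \<in> biane_Omega s" and b: "b \<in> biane_Omega s"
      and eq: "biane_f s a = biane_f s b" and "a \<noteq> b"
    define z where "z = biane_f s a"
    have z1: "norm z < 1"
      using a by (simp add: z_def biane_Omega_def)
    \<comment> \<open>Two fixed points would make \<open>g z\<close> the identity. The point w has
      modulus strictly between |z| and 1, so it cannot be fixed.\<close>
    define w where "w = complex_of_real ((1 + norm z) / 2)"
    have nw: "norm w = (1 + norm z) / 2"
      unfolding w_def norm_of_real by simp
    have "g z w = w"
    proof (rule fixpoints_disc_imp_id[OF holg])
      show "g z ` ball 0 1 \<subseteq> ball 0 1"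
      proof (rule image_subsetI)
        fix x :: complex assume "x \<in> ball 0 1"
        then show "g z x \<in> ball 0 1"
          using g_le[of x z] z1 by simp
      qed
      show "g z a = a" "g z b = b"
        using eq by (auto simp: fix_iff z_def)
      show "a \<in> ball 0 1" "b \<in> ball 0 1" "w \<in> ball 0 1"
        using a b z1 nw by (auto simp: biane_Omega_def)
    qed fact
    then show False
      using g_le[of w z] nw z1 by simp
  qed
  moreover have "ball 0 1 \<subseteq> biane_f s ` biane_Omega s"
  proof
    fix z :: complex assume "z \<in> ball 0 1"
    then have z: "norm z < 1" by simp
    \<comment> \<open>The closed disc of radius \<open>\<rho>\<close> lies in the open unit disc and
      contains the image of \<open>g z\<close>; the radius is positive even for z = 0, as Brouwer's
      theorem requires.\<close>
    define \<rho> where "\<rho> = (1 + norm z) / 2"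
    have \<rho>: "0 < \<rho>" "\<rho> < 1" "norm z < \<rho>"
      using z by (auto simp: \<rho>_def add_pos_nonneg)
    have "continuous_on (cball 0 \<rho>) (g z)"
      using \<rho> by (intro continuous_on_subset[OF holomorphic_on_imp_continuous_on[OF holg]]) auto
    moreover have "g z \<in> cball 0 \<rho> \<rightarrow> cball 0 \<rho>"
    proof
      fix w :: complex assume "w \<in> cball 0 \<rho>"
      then show "g z w \<in> cball 0 \<rho>"
        using g_le[of w z] \<rho> by auto
    qed
    ultimately obtain w where w: "w \<in> cball 0 \<rho>" "g z w = w"
      using brouwer_ball \<rho>(1) by blast
    then have "biane_f s w = z"
      by (simp add: fix_iff)
    moreover have "w \<in> biane_Omega s"
      using w \<rho> z \<open>biane_f s w = z\<close> by (auto simp: biane_Omega_def)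
    ultimately show "z \<in> biane_f s ` biane_Omega s"
      by blast
  qed
  ultimately show ?thesis
    by (auto simp: bij_betw_def biane_Omega_def)
qed

section \<open>The inverse \<open>chi\<close> and the disc self-map \<open>chi2\<close>\<close>

lemma chi_in_Omega:
  assumes "s \<ge> 0" "z \<in> ball 0 1"
  shows "chi s z \<in> biane_Omega s"
  unfolding chi_def
  by (rule bij_betwE[OF bij_betw_the_inv_into[OF bij_betw_biane_f[OF assms(1)]], rule_format, OF assms(2)])

lemma biane_f_chi:
  assumes "s \<ge> 0" "z \<in> ball 0 1"
  shows "biane_f s (chi s z) = z"
  unfolding chi_def using bij_betw_biane_f[OF assms(1)] assms(2) by (rule f_the_inv_into_f_bij_betw)

text \<open>An injective holomorphic map on an open set has a holomorphic inverse on its image; on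
  the disc that inverse must be \<open>chi s\<close>.\<close>

lemma holomorphic_chi:
  assumes "s \<ge> 0"
  shows "chi s holomorphic_on ball 0 1"
proof -
  have inj: "inj_on (biane_f s) (biane_Omega s)"
    and im: "biane_f s ` biane_Omega s = ball 0 1"
    using bij_betw_biane_f[OF assms] by (auto simp: bij_betw_def)
  have "biane_f s holomorphic_on biane_Omega s"
    using holomorphic_biane_f by (rule holomorphic_on_subset) (auto simp: biane_Omega_def)
  then obtain h where h: "h holomorphic_on biane_f s ` biane_Omega s"
    "\<And>z. z \<in> biane_Omega s \<Longrightarrow> h (biane_f s z) = z"
    using holomorphic_has_inverse open_biane_Omega inj by metis
  have "h z = chi s z" if "z \<in> ball 0 1" for z
    using h(2)[OF chi_in_Omega] biane_f_chi assms that by metis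
  then show ?thesis
    using h(1) im holomorphic_cong by metis
qed

lemma holomorphic_chi2:
  assumes "s \<ge> 0"
  shows "chi2 s t holomorphic_on ball 0 1"
proof -
  have "biane_f (s - t) \<circ> chi s holomorphic_on ball 0 1"
    using chi_in_Omega[OF assms]
    by (intro holomorphic_on_compose_gen[OF holomorphic_chi[OF assms] holomorphic_biane_f])
       (auto simp: biane_Omega_def)
  then show ?thesis
    by (simp add: o_def chi2_def[abs_def])
qed

text \<open>With w = \<open>chi s z\<close> in \<open>biane_Omega s\<close>, lowering the parameter
  from s to s - t can only decrease |\<open>biane_f s w\<close>|, which is already below 1.\<close>

lemma norm_chi2_less_1:
  assumes "s \<ge> 0" "t \<ge> 0" "norm z < 1"
  shows "norm (chi2 s t z) < 1"
proof -
  have "chi s z \<in> biane_Omega s"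
    using assms by (intro chi_in_Omega) auto
  then show ?thesis
    using norm_biane_f_mono[of "s - t" s "chi s z"] assms(2)
    by (auto simp: chi2_def biane_Omega_def)
qed

lemma chi2_0:
  assumes "s \<ge> 0"
  shows "chi2 s t 0 = 0"
proof -
  have "0 \<in> biane_Omega s"
    by (simp add: biane_Omega_def)
  then have "chi s 0 = 0"
    unfolding chi_def
    by (intro the_inv_into_f_eq) (use bij_betw_biane_f[OF assms] in \<open>auto simp: bij_betw_def\<close>)
  then show ?thesis
    by (simp add: chi2_def)
qed

text \<open>The exponential factor of \<open>biane_f 0\<close> is 1, so this map is the identity.
  For s = t the two kernels therefore have the same description.\<close>

lemma chi2_self: "chi2 s s = chi s"
  by (simp add: chi2_def biane_f_def fun_eq_iff)

subsection \<open>Herglotz measures\<close>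

text \<open>Cauchy's integral formula as an average over [0, 1]: the derivative of the
  parametrisation supplies the factor \<open>cis (2 * pi * t)\<close>, and 2 pi i cancels.\<close>

lemma circle_mean_cauchy:
  assumes holf: "f holomorphic_on cball 0 1" and w: "norm w < 1"
  shows "((\<lambda>t. f (cis (2 * pi * t)) * cis (2 * pi * t) / (cis (2 * pi * t) - w)) has_integral f w) {0..1}"
proof -
  have exp_eq: "exp (2 * complex_of_real pi * \<i> * complex_of_real t) = cis (2 * pi * t)" for t
    by (simp add: cis_conv_exp mult_ac)
  have "((\<lambda>u. f u / (u - w)) has_contour_integral (2 * of_real pi * \<i> * f w)) (circlepath 0 1)"
    using assms by (intro Cauchy_integral_circlepath_simple) auto
  then have "((\<lambda>t. f (circlepath 0 1 t) / (circlepath 0 1 t - w)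
      * vector_derivative (circlepath 0 1) (at t)) has_integral (2 * of_real pi * \<i> * f w)) {0..1}"
    by (simp only: has_contour_integral)
  then have "((\<lambda>t. f (cis (2 * pi * t)) / (cis (2 * pi * t) - w) * (2 * pi * \<i> * cis (2 * pi * t)))
      has_integral (2 * of_real pi * \<i> * f w)) {0..1}"
    unfolding vector_derivative_circlepath unfolding circlepath exp_eq by simp
  then have "((\<lambda>t. (f (cis (2 * pi * t)) / (cis (2 * pi * t) - w) * (2 * pi * \<i> * cis (2 * pi * t)))
      * inverse (2 * pi * \<i>)) has_integral (2 * of_real pi * \<i> * f w) * inverse (2 * pi * \<i>)) {0..1}"
    by (rule has_integral_mult_left)
  then show ?thesis
    by (simp add: field_simps)
qed

lemma circle_mean_Re:
  assumes "f holomorphic_on cball 0 1"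
  shows "((\<lambda>t. Re (f (cis (2 * pi * t)))) has_integral Re (f 0)) {0..1}"
  using has_integral_Re[OF circle_mean_cauchy[OF assms, of 0]] by simp

text \<open>Links the integrand of the generating function, taken at \<open>inverse u\<close>, to
  the Cauchy kernel. On the circle \<open>inverse u\<close> is the conjugate of u.\<close>

lemma Cauchy_kernel_inverse:
  fixes u w :: complex
  assumes "u \<noteq> 0"
  shows "w * inverse u / (1 - w * inverse u) = w / (u - w)"
proof -
  have "u * (w * inverse u) = w" "u * (1 - w * inverse u) = u - w"
    using assms by (simp_all add: field_simps)
  then show ?thesis
    using mult_divide_mult_cancel_left[OF assms] by metis
qed

text \<open>Pairing with the Cauchy kernel isolates the holomorphic half of \<open>Re f = (f + cnj f) / 2\<close>:
  on the circle the kernel is the conjugate of a function that is holomorphic in the disc and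
  vanishes at the origin, so \<open>cnj f\<close> contributes nothing.\<close>

lemma circle_mean_Cauchy_kernel_Re:
  assumes holf: "f holomorphic_on cball 0 1" and w: "norm w < 1"
  shows "((\<lambda>t. Re (f (cis (2 * pi * t))) *\<^sub>R (w / (cis (2 * pi * t) - w))) has_integral (f w - f 0) / 2) {0..1}"
proof -
  define e where "e t = cis (2 * pi * t)" for t
  have ne: "e t - w \<noteq> 0" "e t \<noteq> 0" for t
    using w by (auto simp: e_def)
  have 1: "((\<lambda>t. f (e t) * (w / (e t - w))) has_integral f w - f 0) {0..1}"
  proof -
    \<comment> \<open>Subtract the formula at 0 from the formula at w, using u / (u - w) - 1 = w /
      (u - w).\<close>
    have "((\<lambda>t. f (e t) * e t / (e t - w) - f (e t) * e t / (e t - 0)) has_integral f w - f 0) {0..1}"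
      unfolding e_def by (intro has_integral_diff circle_mean_cauchy holf) (use w in auto)
    moreover have "f (e t) * e t / (e t - w) - f (e t) * e t / (e t - 0) = f (e t) * (w / (e t - w))" for t
      using ne[of t] by (simp add: field_simps)
    ultimately show ?thesis
      by simp
  qed
  have 2: "((\<lambda>t. cnj (f (e t)) * (w / (e t - w))) has_integral 0) {0..1}"
  proof -
    define h where "h u = f u * (cnj w * u / (1 - cnj w * u))" for u
    have ne': "1 - cnj w * u \<noteq> 0" if "norm u \<le> 1" for u
    proof -
      have "norm (cnj w * u) < 1"
        using mult_left_le[of "norm u" "norm w"] that w by (simp add: norm_mult)
      then show ?thesis
        by auto
    qed
    have "h holomorphic_on cball 0 1"
      unfolding h_def by (intro holomorphic_intros holf) (use ne' in auto)
    then have "((\<lambda>t. h (e t) * e t / (e t - 0)) has_integral h 0) {0..1}"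
      unfolding e_def by (rule circle_mean_cauchy) simp
    then have "((\<lambda>t. cnj (h (e t))) has_integral cnj (h 0)) {0..1}"
      using ne by (simp add: has_integral_cnj[unfolded o_def])
    moreover have "cnj (h (e t)) = cnj (f (e t)) * (w / (e t - w))" for t
    proof -
      have "cnj (e t) = inverse (e t)"
        by (simp add: e_def cis_cnj)
      then show ?thesis
        by (simp only: h_def complex_cnj_mult complex_cnj_divide complex_cnj_diff complex_cnj_one
            complex_cnj_cnj Cauchy_kernel_inverse[OF ne(2)])
    qed
    ultimately show ?thesis
      by (simp add: h_def)
  qed
  have "((\<lambda>t. (f (e t) * (w / (e t - w)) + cnj (f (e t)) * (w / (e t - w))) / 2)
      has_integral (f w - f 0 + 0) / 2) {0..1}"
    by (intro has_integral_divide has_integral_add 1 2)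
  moreover have "(f (e t) * (w / (e t - w)) + cnj (f (e t)) * (w / (e t - w))) / 2
      = Re (f (e t)) *\<^sub>R (w / (e t - w))" for t
  proof -
    have "(f (e t) * (w / (e t - w)) + cnj (f (e t)) * (w / (e t - w))) / 2
      = (f (e t) + cnj (f (e t))) / 2 * (w / (e t - w))"
      by (simp only: distrib_right times_divide_eq_left)
    also have "(f (e t) + cnj (f (e t))) / 2 = of_real (Re (f (e t)))"
      by (simp add: complex_add_cnj)
    finally show ?thesis
      by (simp only: scaleR_conv_of_real)
  qed
  ultimately show ?thesis
    by (simp only: e_def add_0_right)
qed

text \<open>When f extends to the closed disc the measure is explicit: its density on [0, 1] is Re f
  at \<open>cis (2 * pi * t)\<close>, with mass Re f(0) = 1 by the mean value property. The
  half-open interval has the shape used in the definition of \<open>tight\<close>.\<close>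

lemma herglotz_approx:
  assumes holf: "f holomorphic_on cball 0 1" and pos: "\<And>z. norm z = 1 \<Longrightarrow> Re (f z) \<ge> 0"
    and f0: "f 0 = 1"
  obtains \<mu> :: "real measure" where "real_distribution \<mu>" "measure \<mu> {- 1<..1} = 1"
    "\<And>w. norm w < 1 \<Longrightarrow> (\<integral>t. w / (cis (2 * pi * t) - w) \<partial>\<mu>) = (f w - 1) / 2"
proof -
  define p where "p t = Re (f (cis (2 * pi * t)))" for t
  define d where "d t = indicator {0..1} t * p t" for t :: real
  have contf: "continuous_on UNIV (\<lambda>t. f (cis (2 * pi * t)))"
    by (rule continuous_on_compose2[OF holomorphic_on_imp_continuous_on[OF holf]])
       (auto intro!: continuous_intros)
  have contp: "continuous_on {0..1} p"
    unfolding p_def by (intro continuous_on_Re continuous_on_subset[OF contf]) auto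
  have int_p: "set_integrable lborel {0..1} p"
    by (rule borel_integrable_atLeastAtMost'[OF contp])
  have d_nonneg: "d t \<ge> 0" for t
    using pos by (auto simp: d_def p_def indicator_def)
  have int_d: "integrable lborel d"
    using int_p by (simp add: set_integrable_def d_def[abs_def])
  have d_eq: "(\<integral>t. d t \<partial>lborel) = 1"
  proof -
    have "(\<integral>t. d t \<partial>lborel) = integral {0..1} p"
      using set_borel_integral_eq_integral(2)[OF int_p]
      by (simp add: set_lebesgue_integral_def d_def[abs_def])
    also have "\<dots> = 1"
      using integral_unique[OF circle_mean_Re[OF holf]] f0 by (simp add: p_def[abs_def])
    finally show ?thesis .
  qed
  define \<mu> where "\<mu> = density lborel d"
  have [measurable]: "d \<in> borel_measurable borel"
    using int_d by auto
  have total: "emeasure \<mu> A = 1" if "{0..1} \<subseteq> A" "A \<in> sets borel" for A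
  proof -
    have "emeasure \<mu> A = (\<integral>\<^sup>+t. ennreal (d t) * indicator A t \<partial>lborel)"
      using that by (simp add: \<mu>_def emeasure_density)
    also have "\<dots> = (\<integral>\<^sup>+t. ennreal (d t) \<partial>lborel)"
      using that(1) by (intro nn_integral_cong) (auto simp: d_def indicator_def)
    also have "\<dots> = 1"
      using nn_integral_eq_integral[OF int_d] d_nonneg d_eq by simp
    finally show ?thesis .
  qed
  have sets_\<mu>: "sets \<mu> = sets borel"
    by (simp add: \<mu>_def)
  have "prob_space \<mu>"
    by (rule prob_spaceI) (use total[of UNIV] in \<open>simp add: \<mu>_def\<close>)
  then have "real_distribution \<mu>"
    using sets_\<mu> by (simp add: real_distribution_def real_distribution_axioms_def \<mu>_def)
  moreover have "emeasure \<mu> {- 1<..1} = 1"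
    by (rule total) auto
  then have "measure \<mu> {- 1<..1} = 1"
    by (simp add: measure_def)
  moreover have "(\<integral>t. w / (cis (2 * pi * t) - w) \<partial>\<mu>) = (f w - 1) / 2" if w: "norm w < 1" for w
  proof -
    define q where "q t = w / (cis (2 * pi * t) - w)" for t
    have ne: "cis a \<noteq> w" for a
      using w by auto
    have contq: "continuous_on UNIV q"
      unfolding q_def by (intro continuous_intros) (use ne in auto)
    have int_pq: "set_integrable lborel {0..1} (\<lambda>t. p t *\<^sub>R q t)"
      by (intro borel_integrable_atLeastAtMost' continuous_intros contp continuous_on_subset[OF contq]) auto
    have "(\<integral>t. q t \<partial>\<mu>) = (\<integral>t. d t *\<^sub>R q t \<partial>lborel)"
      unfolding \<mu>_def
      by (intro integral_density) (use d_nonneg contq in \<open>auto intro: borel_measurable_continuous_onI\<close>)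
    also have "\<dots> = (LINT t:{0..1}|lborel. p t *\<^sub>R q t)"
      by (simp add: set_lebesgue_integral_def d_def)
    also have "\<dots> = integral {0..1} (\<lambda>t. p t *\<^sub>R q t)"
      by (rule set_borel_integral_eq_integral(2)[OF int_pq])
    also have "\<dots> = (f w - 1) / 2"
      using integral_unique[OF circle_mean_Cauchy_kernel_Re[OF holf w]] f0 by (simp add: p_def q_def)
    finally show ?thesis
      by (simp add: q_def)
  qed
  ultimately show thesis
    using that by blast
qed

text \<open>For fixed z the bound is uniform over the circle. This gives integrability and makes the
  kernel a bounded test function for weak convergence.\<close>

lemma norm_circle_kernel_le:
  fixes z w :: complex
  assumes "norm w = 1" "norm z < 1"
  shows "norm (z * w / (1 - z * w)) \<le> norm z / (1 - norm z)"
proof -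
  have "1 - norm z \<le> norm (1 - z * w)"
    using norm_triangle_ineq2[of 1 "z * w"] assms by (simp add: norm_mult)
  then show ?thesis
    unfolding norm_divide norm_mult assms(1) using assms(2) by (intro frac_le) auto
qed

text \<open>The dilations H(r z) with r < 1 are holomorphic on the closed disc, so they have
  explicit measures. These all live on one bounded interval; tightness yields a weak limit, which is
  then carried to the circle.\<close>

lemma herglotz_exists:
  assumes holH: "H holomorphic_on ball 0 1" and pos: "\<And>z. norm z < 1 \<Longrightarrow> Re (H z) \<ge> 0"
    and H0: "H 0 = 1"
  obtains \<mu> where "circle_prob \<mu>"
    "\<And>z. norm z < 1 \<Longrightarrow> (\<integral>\<omega>. z * \<omega> / (1 - z * \<omega>) \<partial>\<mu>) = (H z - 1) / 2"
proof -
  define r where "r n = complex_of_real (real n / real (Suc n))" for n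
  have r1: "norm (r n) < 1" for n
    by (simp add: r_def norm_divide divide_simps del: of_nat_Suc)
  have rz: "norm (r n * z) < 1" if "norm z \<le> 1" for n z
    using mult_left_le[of "norm z" "norm (r n)"] that r1[of n] by (simp add: norm_mult)
  have r_lim: "r \<longlonglongrightarrow> 1"
    unfolding r_def using tendsto_of_real[OF LIMSEQ_n_over_Suc_n, where 'a = complex] by simp
  have "\<exists>\<mu>. real_distribution \<mu> \<and> measure \<mu> {- 1<..1} = 1 \<and>
    (\<forall>w. norm w < 1 \<longrightarrow> (\<integral>t. w / (cis (2 * pi * t) - w) \<partial>\<mu>) = (H (r n * w) - 1) / 2)" for n
  proof -
    have "H \<circ> (*) (r n) holomorphic_on cball 0 1"
      by (intro holomorphic_on_compose_gen[OF _ holH] holomorphic_intros) (use rz in auto)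
    from herglotz_approx[OF this] show ?thesis
      using pos rz H0 by (smt (verit, ccfv_threshold) comp_def mult_zero_right)
  qed
  then obtain \<mu> where \<mu>: "\<And>n. real_distribution (\<mu> n)" "\<And>n. measure (\<mu> n) {- 1<..1} = 1"
    "\<And>n w. norm w < 1 \<Longrightarrow> (\<integral>t. w / (cis (2 * pi * t) - w) \<partial>\<mu> n) = (H (r n * w) - 1) / 2"
    by metis
  \<comment> \<open>The interval (-1, 1] carries full mass for every n, so it works for every
    epsilon.\<close>
  have "tight \<mu>"
    unfolding tight_def using \<mu>(1,2)
    by (intro conjI allI impI exI[of _ "- 1 :: real"] exI[of _ "1 :: real"]) auto
  then obtain k M where k: "strict_mono (k :: nat \<Rightarrow> nat)" and M: "real_distribution M"
    and conv: "weak_conv_m (\<mu> \<circ> id \<circ> k) M"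
    using tight_imp_convergent_subsubsequence[of \<mu> id] strict_mono_id by auto
  interpret M: real_distribution M by fact
  \<comment> \<open>The minus sign is the conjugation from \<open>Cauchy_kernel_inverse\<close>: at
    \<open>c t\<close> the integrand of the generating function becomes the Cauchy kernel at
    \<open>cis (2 * pi * t)\<close>.\<close>
  define c where "c t = cis (- (2 * pi * t))" for t
  have c_borel: "c \<in> borel \<rightarrow>\<^sub>M borel"
    unfolding c_def by (intro borel_measurable_continuous_onI continuous_intros)
  have [measurable]: "c \<in> borel \<rightarrow>\<^sub>M circle_borel"
    unfolding circle_borel_def by (intro measurable_restrict_space2 c_borel) (auto simp: c_def)
  define \<nu> where "\<nu> = distr M circle_borel c"
  have "circle_prob \<nu>"
    unfolding circle_prob_def \<nu>_def by (auto intro!: M.prob_space_distr)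
  moreover have "(\<integral>\<omega>. z * \<omega> / (1 - z * \<omega>) \<partial>\<nu>) = (H z - 1) / 2" if z: "norm z < 1" for z
  proof -
    define q where "q t = z / (cis (2 * pi * t) - z)" for t
    have ne: "cis a \<noteq> z" for a
      using z by auto
    have q_eq: "z * c t / (1 - z * c t) = q t" for t
    proof -
      have "c t = inverse (cis (2 * pi * t))"
        by (simp add: c_def flip: cis_inverse)
      then show ?thesis
        using Cauchy_kernel_inverse[of "cis (2 * pi * t)" z] by (simp add: q_def)
    qed
    have q_bound: "norm (q t) \<le> norm z / (1 - norm z)" for t
      using norm_circle_kernel_le[of "c t" z] z unfolding q_eq by (simp add: c_def)
    have "continuous_on UNIV q"
      unfolding q_def by (intro continuous_intros) (use ne in auto)
    then have cont_q: "isCont q t" for t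
      by (simp add: continuous_on_eq_continuous_at)
    have "(\<integral>\<omega>. z * \<omega> / (1 - z * \<omega>) \<partial>\<nu>) = (\<integral>t. z * c t / (1 - z * c t) \<partial>M)"
      unfolding \<nu>_def
    proof (rule integral_distr)
      show "(\<lambda>\<omega>. z * \<omega> / (1 - z * \<omega>)) \<in> borel_measurable circle_borel"
        unfolding circle_borel_def by (intro measurable_restrict_space1) measurable
    qed simp
    then have "(\<integral>\<omega>. z * \<omega> / (1 - z * \<omega>) \<partial>\<nu>) = (\<integral>t. q t \<partial>M)"
      by (simp only: q_eq)
    moreover have "(\<lambda>n. \<integral>t. q t \<partial>(\<mu> \<circ> id \<circ> k) n) \<longlonglongrightarrow> (\<integral>t. q t \<partial>M)"
      by (rule weak_conv_imp_integral_bdd_continuous_conv[OF _ M conv cont_q q_bound])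
         (simp add: \<mu>(1))
    \<comment> \<open>The same integrals are known in closed form and converge by continuity of H at
      z; comparing the two limits identifies the integral.\<close>
    moreover have "(\<lambda>n. \<integral>t. q t \<partial>(\<mu> \<circ> id \<circ> k) n) \<longlonglongrightarrow> (H z - 1) / 2"
    proof -
      have "isCont H z"
        using holomorphic_on_imp_continuous_on[OF holH] z
        by (simp add: continuous_on_eq_continuous_at)
      moreover have "(\<lambda>n. r (k n) * z) \<longlonglongrightarrow> z"
        using tendsto_mult_right[OF LIMSEQ_subseq_LIMSEQ[OF r_lim k], of z] by (simp add: o_def)
      ultimately have "(\<lambda>n. H (r (k n) * z)) \<longlonglongrightarrow> H z"
        by (rule isCont_tendsto_compose)
      then have "(\<lambda>n. (H (r (k n) * z) - 1) / 2) \<longlonglongrightarrow> (H z - 1) / 2"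
        by (intro tendsto_intros) auto
      then show ?thesis
        unfolding q_def by (simp add: \<mu>(3)[OF z])
    qed
    ultimately show ?thesis
      using LIMSEQ_unique by metis
  qed
  ultimately show thesis
    using that by blast
qed

subsection \<open>Moments determine a measure on the circle\<close>

lemma circle_prob_measurable_borel:
  assumes "circle_prob \<mu>" "f \<in> borel_measurable borel"
  shows "f \<in> borel_measurable \<mu>"
proof -
  have "sets \<mu> = sets circle_borel"
    using assms(1) by (simp add: circle_prob_def)
  moreover have "f \<in> borel_measurable circle_borel"
    unfolding circle_borel_def using assms(2) by (rule measurable_restrict_space1)
  ultimately show ?thesis
    using measurable_cong_sets by blast
qed

lemma circle_prob_space: "circle_prob \<mu> \<Longrightarrow> space \<mu> = sphere 0 1"
  using sets_eq_imp_space_eq[of \<mu> circle_borel]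
  by (simp add: circle_prob_def circle_borel_def space_restrict_space)

lemma circle_prob_imp_prob_space: "circle_prob \<mu> \<Longrightarrow> prob_space \<mu>"
  by (simp add: circle_prob_def)

lemma circle_prob_integrable:
  fixes f :: "complex \<Rightarrow> 'a :: {banach, second_countable_topology}"
  assumes \<mu>: "circle_prob \<mu>" and f: "f \<in> borel_measurable borel"
    and bound: "\<And>w. norm w = 1 \<Longrightarrow> norm (f w) \<le> B"
  shows "integrable \<mu> f"
proof -
  interpret prob_space \<mu>
    using \<mu> by (rule circle_prob_imp_prob_space)
  show ?thesis
    using circle_prob_measurable_borel[OF \<mu> f] bound circle_prob_space[OF \<mu>]
    by (intro integrable_const_bound[of _ B] AE_I2) auto
qed

text \<open>Geometric expansion of 1 / (1 - z w) = 1 + z w / (1 - z w). On the circle the n-th term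
  has modulus |z|^n, which is summable and permits termwise integration; the total mass 1 is the
  summand of index 0.\<close>

lemma circle_moments_sums:
  assumes \<mu>: "circle_prob \<mu>" and z: "norm z < 1"
  shows "(\<lambda>n. (\<integral>w. w ^ n \<partial>\<mu>) * z ^ n) sums (1 + (\<integral>w. z * w / (1 - z * w) \<partial>\<mu>))"
proof -
  interpret prob_space \<mu>
    using \<mu> by (rule circle_prob_imp_prob_space)
  have nzw: "norm (z * w) = norm z" if "w \<in> space \<mu>" for w
    using that circle_prob_space[OF \<mu>] by (simp add: norm_mult)
  have int_pow: "integrable \<mu> (\<lambda>w. w ^ n)" for n
    by (rule circle_prob_integrable[OF \<mu>, of _ 1]) (auto simp: norm_power)
  have int_k: "integrable \<mu> (\<lambda>w. z * w / (1 - z * w))"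
  proof (rule circle_prob_integrable[OF \<mu>])
    show "norm (z * w / (1 - z * w)) \<le> norm z / (1 - norm z)" if "norm w = 1" for w
      using norm_circle_kernel_le[OF that z] .
  qed measurable
  have "(\<lambda>n. \<integral>w. (z * w) ^ n \<partial>\<mu>) sums (\<integral>w. (\<Sum>n. (z * w) ^ n) \<partial>\<mu>)"
  proof (rule sums_integral)
    show "integrable \<mu> (\<lambda>w. (z * w) ^ n)" for n
      using int_pow[of n] by (simp add: power_mult_distrib)
    show "AE w in \<mu>. summable (\<lambda>n. norm ((z * w) ^ n))"
      using nzw z by (intro AE_I2) (simp add: norm_power summable_geometric)
    have "(\<integral>w. norm ((z * w) ^ n) \<partial>\<mu>) = norm z ^ n" for n
      using nzw by (subst Bochner_Integration.integral_cong[where N = \<mu> and g = "\<lambda>_. norm z ^ n"])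
        (auto simp: norm_power prob_space)
    then show "summable (\<lambda>n. \<integral>w. norm ((z * w) ^ n) \<partial>\<mu>)"
      using z by (simp add: summable_geometric)
  qed
  moreover have "(\<integral>w. (z * w) ^ n \<partial>\<mu>) = (\<integral>w. w ^ n \<partial>\<mu>) * z ^ n" for n
    by (simp add: power_mult_distrib mult.commute)
  moreover have "(\<integral>w. (\<Sum>n. (z * w) ^ n) \<partial>\<mu>) = (\<integral>w. 1 + z * w / (1 - z * w) \<partial>\<mu>)"
  proof (rule Bochner_Integration.integral_cong)
    fix w assume "w \<in> space \<mu>"
    then have nw: "norm (z * w) < 1"
      using nzw z by simp
    then have "1 - z * w \<noteq> 0"
      by auto
    then show "(\<Sum>n. (z * w) ^ n) = 1 + z * w / (1 - z * w)"
      using suminf_geometric[OF nw] by (simp add: field_simps)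
  qed simp
  ultimately show ?thesis
    using int_k by (simp add: prob_space)
qed

text \<open>The differences of moments are the coefficients of a power series with sum 0 on the
  disc; a nonzero coefficient would make the sum nonzero at points near 0.\<close>

lemma circle_moments_eq:
  assumes \<mu>: "circle_prob \<mu>" and \<nu>: "circle_prob \<nu>"
    and eq: "\<And>z. norm z < 1 \<Longrightarrow> (\<integral>w. z * w / (1 - z * w) \<partial>\<mu>) = (\<integral>w. z * w / (1 - z * w) \<partial>\<nu>)"
  shows "(\<integral>w. w ^ n \<partial>\<mu>) = (\<integral>w. w ^ n \<partial>\<nu>)"
proof (rule ccontr)
  interpret \<mu>: prob_space \<mu>
    using \<mu> by (rule circle_prob_imp_prob_space)
  interpret \<nu>: prob_space \<nu>
    using \<nu> by (rule circle_prob_imp_prob_space)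
  define a where "a n = (\<integral>w. w ^ n \<partial>\<mu>) - (\<integral>w. w ^ n \<partial>\<nu>)" for n
  assume "(\<integral>w. w ^ n \<partial>\<mu>) \<noteq> (\<integral>w. w ^ n \<partial>\<nu>)"
  \<comment> \<open>Both masses are 1, so \<open>a 0\<close> vanishes and a differing index is
    positive, as \<open>powser_0_nonzero\<close> demands.\<close>
  then have an: "a n \<noteq> 0" and "n > 0"
    by (auto simp: a_def \<mu>.prob_space \<nu>.prob_space intro: gr0I)
  have "(\<lambda>n. a n * (z - 0) ^ n) sums 0" if "norm (z - 0) < 1" for z
    using sums_diff[OF circle_moments_sums[OF \<mu>] circle_moments_sums[OF \<nu>], of z z] that eq[of z]
    by (simp add: a_def algebra_simps)
  from powser_0_nonzero[OF zero_less_one this _ an \<open>n > 0\<close>]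
  obtain r :: real where "r > 0" "\<And>z :: complex. z \<in> cball 0 r - {0} \<Longrightarrow> (0 :: complex) \<noteq> 0"
    by metis
  from this(2)[of "complex_of_real r"] \<open>r > 0\<close> show False
    by simp
qed

text \<open>Conjugation inverts points of the circle, so integrals of negative powers are conjugates
  of moments. The quotient form covers both signs of i - n.\<close>

lemma circle_integral_power_div_power_eq:
  assumes \<mu>: "circle_prob \<mu>" and \<nu>: "circle_prob \<nu>"
    and eq: "\<And>n. (\<integral>w. w ^ n \<partial>\<mu>) = (\<integral>w. w ^ n \<partial>\<nu>)"
  shows "(\<integral>w. w ^ i / w ^ n \<partial>\<mu>) = (\<integral>w. w ^ i / w ^ n \<partial>\<nu>)"
proof (cases "n \<le> i")
  case True
  have "(\<integral>w. w ^ i / w ^ n \<partial>\<kappa>) = (\<integral>w. w ^ (i - n) \<partial>\<kappa>)" if "circle_prob \<kappa>" for \<kappa>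
  proof (rule Bochner_Integration.integral_cong)
    fix w assume "w \<in> space \<kappa>"
    then have "w \<noteq> 0"
      using circle_prob_space[OF that] by auto
    then show "w ^ i / w ^ n = w ^ (i - n)"
      using True by (simp add: power_diff)
  qed simp
  then show ?thesis
    using \<mu> \<nu> eq by simp
next
  case False
  have "(\<integral>w. w ^ i / w ^ n \<partial>\<kappa>) = cnj (\<integral>w. w ^ (n - i) \<partial>\<kappa>)" if "circle_prob \<kappa>" for \<kappa>
  proof -
    have "w ^ i / w ^ n = cnj (w ^ (n - i))" if "w \<in> space \<kappa>" for w
    proof -
      have nw: "norm w = 1"
        using that circle_prob_space[OF \<open>circle_prob \<kappa>\<close>] by simp
      then have "w \<noteq> 0"
        by auto
      have "cnj w = inverse w"
        using nw complex_norm_square[of w] by (intro inverse_unique[symmetric]) simp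
      moreover have "w ^ n = w ^ i * w ^ (n - i)"
        using False by (simp flip: power_add)
      ultimately show ?thesis
        using \<open>w \<noteq> 0\<close> by (simp add: divide_inverse power_inverse)
    qed
    then have "(\<integral>w. w ^ i / w ^ n \<partial>\<kappa>) = (\<integral>w. cnj (w ^ (n - i)) \<partial>\<kappa>)"
      by (intro Bochner_Integration.integral_cong) auto
    then show ?thesis
      by (simp only: Bochner_Integration.integral_cnj)
  qed
  then show ?thesis
    using \<mu> \<nu> eq by simp
qed

text \<open>On the circle \<open>cnj w = 1 / w\<close>, so real polynomials in the coordinates are Laurent polynomials.\<close>

lemma real_polynomial_function_circle_Laurent:
  assumes "real_polynomial_function (f :: complex \<Rightarrow> real)"
  shows "\<exists>n p. \<forall>w. norm w = 1 \<longrightarrow> complex_of_real (f w) * w ^ n = poly p w"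
  using assms
proof (induction rule: real_polynomial_function.induct)
  case (linear f)
  \<comment> \<open>Expand f(w) = Re w f(1) + Im w f(i), insert Re w = (w + 1/w) / 2 and Im w = (w -
    1/w) / (2 i), and multiply by w.\<close>
  define p where "p = [: (of_real (f 1) + \<i> * of_real (f \<i>)) / 2, 0, (of_real (f 1) - \<i> * of_real (f \<i>)) / 2 :]"
  have "complex_of_real (f w) * w ^ 1 = poly p w" if "norm w = 1" for w
  proof -
    interpret bounded_linear f by fact
    have "w = Re w *\<^sub>R 1 + Im w *\<^sub>R \<i>"
      by (simp add: complex_eq_iff)
    then have "f w = Re w * f 1 + Im w * f \<i>"
      by (metis add scaleR real_scaleR_def)
    then have "complex_of_real (f w) * w
        = of_real (f 1) * (of_real (Re w) * w) + of_real (f \<i>) * (of_real (Im w) * w)"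
      by (simp add: algebra_simps)
    moreover have "w * cnj w = 1"
      using that complex_norm_square[of w] by simp
    moreover have "of_real (Re w) * w = (w * w + w * cnj w) / 2"
      "of_real (Im w) * w = - \<i> * (w * w - w * cnj w) / 2"
      by (simp_all add: complex_eq_iff algebra_simps)
    ultimately have "complex_of_real (f w) * w
        = of_real (f 1) * ((w * w + 1) / 2) + of_real (f \<i>) * (- \<i> * (w * w - 1) / 2)"
      by (simp only:)
    then show ?thesis
      unfolding p_def by (simp add: field_simps)
  qed
  then show ?case
    by blast
next
  case (const c)
  have "complex_of_real c * w ^ 0 = poly [:of_real c:] w" for w
    by simp
  then show ?case
    by blast
next
  case (add f g)
  then obtain n p m q where *: "\<And>w. norm w = 1 \<Longrightarrow> complex_of_real (f w) * w ^ n = poly p w"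
    "\<And>w. norm w = 1 \<Longrightarrow> complex_of_real (g w) * w ^ m = poly q w"
    by metis
  have "complex_of_real (f w + g w) * w ^ (n + m) = poly (p * monom 1 m + q * monom 1 n) w"
    if "norm w = 1" for w
    using *[OF that, symmetric] by (simp add: poly_monom power_add algebra_simps)
  then show ?case
    by blast
next
  case (mult f g)
  then obtain n p m q where *: "\<And>w. norm w = 1 \<Longrightarrow> complex_of_real (f w) * w ^ n = poly p w"
    "\<And>w. norm w = 1 \<Longrightarrow> complex_of_real (g w) * w ^ m = poly q w"
    by metis
  have "complex_of_real (f w * g w) * w ^ (n + m) = poly (p * q) w" if "norm w = 1" for w
    using *[OF that, symmetric] by (simp add: power_add algebra_simps)
  then show ?case
    by blast
qed

text \<open>Dividing the polynomial identity by w^n makes f on the circle a finite combination of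
  the quotients w^i / w^n, whose integrals agree.\<close>

lemma circle_integral_polynomial_eq:
  assumes \<mu>: "circle_prob \<mu>" and \<nu>: "circle_prob \<nu>"
    and eq: "\<And>n. (\<integral>w. w ^ n \<partial>\<mu>) = (\<integral>w. w ^ n \<partial>\<nu>)"
    and f: "real_polynomial_function f"
  shows "(\<integral>w. f w \<partial>\<mu>) = (\<integral>w. f w \<partial>\<nu>)"
proof -
  obtain n p where p: "\<And>w. norm w = 1 \<Longrightarrow> complex_of_real (f w) * w ^ n = poly p w"
    using real_polynomial_function_circle_Laurent[OF f] by metis
  have int: "complex_of_real (\<integral>w. f w \<partial>\<kappa>) = (\<Sum>i\<le>degree p. coeff p i * (\<integral>w. w ^ i / w ^ n \<partial>\<kappa>))"
    if \<kappa>: "circle_prob \<kappa>" for \<kappa>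
  proof -
    have ik: "integrable \<kappa> (\<lambda>w. w ^ i / w ^ n)" for i
      by (rule circle_prob_integrable[OF \<kappa>, of _ 1]) (auto simp: norm_divide norm_power)
    have "complex_of_real (f w) = (\<Sum>i\<le>degree p. coeff p i * (w ^ i / w ^ n))" if "w \<in> space \<kappa>" for w
    proof -
      have w: "norm w = 1"
        using that circle_prob_space[OF \<kappa>] by simp
      then have "w \<noteq> 0"
        by auto
      then have "complex_of_real (f w) = poly p w / w ^ n"
        using p[OF w] by (simp add: field_simps)
      then show ?thesis
        by (simp add: poly_altdef sum_divide_distrib)
    qed
    then have "(\<integral>w. complex_of_real (f w) \<partial>\<kappa>)
        = (\<integral>w. (\<Sum>i\<le>degree p. coeff p i * (w ^ i / w ^ n)) \<partial>\<kappa>)"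
      by (intro Bochner_Integration.integral_cong) auto
    also have "\<dots> = (\<Sum>i\<le>degree p. \<integral>w. coeff p i * (w ^ i / w ^ n) \<partial>\<kappa>)"
      by (intro Bochner_Integration.integral_sum integrable_mult_right ik)
    also have "\<dots> = (\<Sum>i\<le>degree p. coeff p i * (\<integral>w. w ^ i / w ^ n \<partial>\<kappa>))"
      by (simp only: integral_mult_right_zero)
    finally show ?thesis
      by simp
  qed
  have "complex_of_real (\<integral>w. f w \<partial>\<mu>) = complex_of_real (\<integral>w. f w \<partial>\<nu>)"
    unfolding int[OF \<mu>] int[OF \<nu>] circle_integral_power_div_power_eq[OF \<mu> \<nu> eq] ..
  then show ?thesis
    by simp
qed

text \<open>Stone-Weierstrass gives a real polynomial within e/2 of f on the circle. Under a
  probability measure the integral changes by at most e/2, and the two measures agree on the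
  polynomial.\<close>

lemma circle_integral_continuous_eq:
  fixes f :: "complex \<Rightarrow> real"
  assumes \<mu>: "circle_prob \<mu>" and \<nu>: "circle_prob \<nu>"
    and eq: "\<And>n. (\<integral>w. w ^ n \<partial>\<mu>) = (\<integral>w. w ^ n \<partial>\<nu>)"
    and f: "continuous_on UNIV f"
  shows "(\<integral>w. f w \<partial>\<mu>) = (\<integral>w. f w \<partial>\<nu>)"
proof -
  have fS: "continuous_on (sphere 0 1) f"
    using f by (rule continuous_on_subset) simp
  have int: "integrable \<kappa> g" if \<kappa>: "circle_prob \<kappa>" and g: "continuous_on UNIV g"
    for \<kappa> and g :: "complex \<Rightarrow> real"
  proof -
    have "compact (g ` sphere 0 1)"
      using g by (intro compact_continuous_image) (auto intro: continuous_on_subset)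
    then obtain B where "\<And>w. w \<in> sphere 0 1 \<Longrightarrow> norm (g w) \<le> B"
      using compact_imp_bounded bounded_iff by (metis image_eqI)
    then show ?thesis
      using g by (intro circle_prob_integrable[OF \<kappa>, of _ B]) (auto intro: borel_measurable_continuous_onI)
  qed
  have "\<bar>(\<integral>w. f w \<partial>\<mu>) - (\<integral>w. f w \<partial>\<nu>)\<bar> \<le> e" if e: "e > 0" for e
  proof -
    obtain g where g: "real_polynomial_function g"
      and fg: "\<And>w. w \<in> sphere 0 1 \<Longrightarrow> \<bar>f w - g w\<bar> < e / 2"
      by (rule Stone_Weierstrass_real_polynomial_function[OF compact_sphere fS half_gt_zero[OF e]])
        (rule that; assumption)
    have contg: "continuous_on UNIV g"
      using g by (simp add: continuous_on_polymonial_function real_polynomial_function_eq)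
    have close: "\<bar>(\<integral>w. f w \<partial>\<kappa>) - (\<integral>w. g w \<partial>\<kappa>)\<bar> \<le> e / 2" if \<kappa>: "circle_prob \<kappa>" for \<kappa>
    proof -
      interpret prob_space \<kappa>
        using \<kappa> by (rule circle_prob_imp_prob_space)
      have "\<bar>(\<integral>w. f w \<partial>\<kappa>) - (\<integral>w. g w \<partial>\<kappa>)\<bar> = \<bar>\<integral>w. f w - g w \<partial>\<kappa>\<bar>"
        using int[OF \<kappa> f] int[OF \<kappa> contg] by simp
      also have "\<dots> \<le> (\<integral>w. \<bar>f w - g w\<bar> \<partial>\<kappa>)"
        by (rule integral_abs_bound)
      also have "\<dots> \<le> (\<integral>w. e / 2 \<partial>\<kappa>)"
        using int[OF \<kappa> f] int[OF \<kappa> contg] fg circle_prob_space[OF \<kappa>]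
        by (intro integral_mono) (auto intro: less_imp_le)
      finally show ?thesis
        by (simp add: prob_space)
    qed
    show ?thesis
      using close[OF \<mu>] close[OF \<nu>] circle_integral_polynomial_eq[OF \<mu> \<nu> eq g] by linarith
  qed
  then have "\<bar>(\<integral>w. f w \<partial>\<mu>) - (\<integral>w. f w \<partial>\<nu>)\<bar> \<le> 0"
    by (rule field_le_epsilon) simp
  then show ?thesis
    by simp
qed

text \<open>The indicator of a closed set is a pointwise limit of continuous functions with values
  in [0, 1], so dominated convergence applies.\<close>

lemma circle_measure_closed_eq:
  assumes \<mu>: "circle_prob \<mu>" and \<nu>: "circle_prob \<nu>"
    and eq: "\<And>n. (\<integral>w. w ^ n \<partial>\<mu>) = (\<integral>w. w ^ n \<partial>\<nu>)"
    and F: "closed F"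
  shows "emeasure \<mu> (F \<inter> sphere 0 1) = emeasure \<nu> (F \<inter> sphere 0 1)"
\<comment> \<open>The distance \<open>infdist w {}\<close> has the default value 0, so the functions
  \<open>g k\<close> would be constantly 1 for empty F.\<close>
proof (cases "F = {}")
  case False
  \<comment> \<open>Equal to 1 on F, and to 0 once k times the distance to F reaches 1.\<close>
  define g where "g k w = max 0 (1 - real k * infdist w F)" for k and w :: complex
  have contg: "continuous_on UNIV (g k)" for k
    unfolding g_def by (intro continuous_intros)
  have g_lim: "(\<lambda>k. g k w) \<longlonglongrightarrow> indicator F w" for w
  proof (cases "w \<in> F")
    case True
    then show ?thesis
      by (simp add: g_def)
  next
    case wF: False
    then have pos: "infdist w F > 0"
      using F False infdist_pos_not_in_closed by blast
    obtain N where "1 / infdist w F < real N"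
      using reals_Archimedean2 by blast
    then have N: "1 < real N * infdist w F"
      using pos by (simp add: field_simps)
    have "g k w = 0" if "k \<ge> N" for k
    proof -
      have "real N * infdist w F \<le> real k * infdist w F"
        using that pos by (intro mult_right_mono) auto
      then show ?thesis
        using N by (simp add: g_def)
    qed
    then have "eventually (\<lambda>k. g k w = 0) sequentially"
      by (auto simp: eventually_sequentially)
    then show ?thesis
      using wF by (simp add: tendsto_eventually)
  qed
  have lim: "(\<lambda>k. \<integral>w. g k w \<partial>\<kappa>) \<longlonglongrightarrow> measure \<kappa> (F \<inter> sphere 0 1)" if \<kappa>: "circle_prob \<kappa>" for \<kappa>
  proof -
    interpret prob_space \<kappa>
      using \<kappa> by (rule circle_prob_imp_prob_space)
    have "(\<lambda>k. \<integral>w. g k w \<partial>\<kappa>) \<longlonglongrightarrow> (\<integral>w. indicator F w \<partial>\<kappa>)"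
    proof (rule integral_dominated_convergence[where w = "\<lambda>_. 1"])
      show "AE w in \<kappa>. norm (g k w) \<le> 1" for k
        by (intro AE_I2) (auto simp: g_def infdist_nonneg)
      show "g k \<in> borel_measurable \<kappa>" for k
        using contg by (intro circle_prob_measurable_borel[OF \<kappa>] borel_measurable_continuous_onI)
      show "indicator F \<in> borel_measurable \<kappa>"
        using F by (intro circle_prob_measurable_borel[OF \<kappa>] borel_measurable_indicator) simp
    qed (use g_lim in auto)
    then show ?thesis
      using circle_prob_space[OF \<kappa>] by simp
  qed
  have "measure \<mu> (F \<inter> sphere 0 1) = measure \<nu> (F \<inter> sphere 0 1)"
    using lim[OF \<mu>] lim[OF \<nu>] circle_integral_continuous_eq[OF \<mu> \<nu> eq contg]
    by (auto intro: LIMSEQ_unique)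
  then show ?thesis
    using \<mu> \<nu> by (simp add: finite_measure.emeasure_eq_measure prob_space.finite_measure circle_prob_imp_prob_space)
qed simp

text \<open>Closed sets form an intersection-stable generator of the Borel sets of the plane. Both
  measures are pushed forward to the plane, compared there, and read back on Borel subsets of the
  circle.\<close>

lemma circle_prob_eqI_moments:
  assumes \<mu>: "circle_prob \<mu>" and \<nu>: "circle_prob \<nu>"
    and eq: "\<And>n. (\<integral>w. w ^ n \<partial>\<mu>) = (\<integral>w. w ^ n \<partial>\<nu>)"
  shows "\<mu> = \<nu>"
proof -
  have id: "(\<lambda>w. w) \<in> borel_measurable \<kappa>" if "circle_prob \<kappa>" for \<kappa>
    using that by (rule circle_prob_measurable_borel) simp
  have ed: "emeasure (distr \<kappa> borel (\<lambda>w. w)) A = emeasure \<kappa> (A \<inter> sphere 0 1)"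
    if "circle_prob \<kappa>" "A \<in> sets borel" for \<kappa> A
    using that id[OF that(1)] circle_prob_space[OF that(1)]
    by (simp add: emeasure_distr)
  have d_eq: "distr \<mu> borel (\<lambda>w. w) = distr \<nu> borel (\<lambda>w. w)"
  proof (rule measure_eqI_generator_eq[where \<Omega> = UNIV and E = "Collect closed" and A = "\<lambda>_. UNIV"])
    show "Int_stable (Collect closed)"
      by (auto simp: Int_stable_def)
    show "emeasure (distr \<mu> borel (\<lambda>w. w)) X = emeasure (distr \<nu> borel (\<lambda>w. w)) X"
      if "X \<in> Collect closed" for X
      using that circle_measure_closed_eq[OF \<mu> \<nu> eq, of X] ed[OF \<mu>, of X] ed[OF \<nu>, of X] by simp
    show "emeasure (distr \<mu> borel (\<lambda>w. w)) UNIV \<noteq> \<infinity>" for i :: nat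
    proof -
      interpret prob_space "distr \<mu> borel (\<lambda>w. w)"
        using id[OF \<mu>] by (intro prob_space.prob_space_distr circle_prob_imp_prob_space[OF \<mu>])
      show ?thesis
        using emeasure_finite by simp
    qed
  qed (auto simp: borel_eq_closed)
  show ?thesis
  proof (rule measure_eqI)
    show "sets \<mu> = sets \<nu>"
      using \<mu> \<nu> by (simp add: circle_prob_def)
    fix A assume "A \<in> sets \<mu>"
    then have "A \<in> sets circle_borel"
      using \<mu> by (simp add: circle_prob_def)
    then have A: "A \<in> sets borel" "A \<inter> sphere 0 1 = A"
      by (auto simp: circle_borel_def sets_restrict_space)
    show "emeasure \<mu> A = emeasure \<nu> A"
      using ed[OF \<mu> A(1)] ed[OF \<nu> A(1)] A(2) d_eq by simp
  qed
qed

subsection \<open>The kernel\<close>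

theorem theorem4p6:
  fixes s t :: real and \<zeta> :: complex
  assumes "s > 0" and "t > 0" and "\<zeta> \<in> sphere 0 1"
  shows "(\<exists>!\<mu>. circle_prob \<mu> \<and>
            (\<forall>z\<in>ball 0 1. (\<integral>\<omega>. z * \<omega> / (1 - z * \<omega>) \<partial>\<mu>)
                             = chi2 s t z * \<zeta> / (1 - chi2 s t z * \<zeta>)))
         \<and> (s = t \<longrightarrow> kernel2 s t \<zeta> = biane_kernel s \<zeta>)"
proof (intro conjI impI)
  define h where "h z = chi2 s t z * \<zeta>" for z
  \<comment> \<open>The Cayley transform is chosen so that (H - 1) / 2 = h / (1 - h), the required
    generating function.\<close>
  define H where "H z = (1 + h z) / (1 - h z)" for z
  have h1: "norm (h z) < 1" if "norm z < 1" for z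
    using norm_chi2_less_1[of s t z] assms that by (simp add: h_def norm_mult)
  have ne: "1 - h z \<noteq> 0" if "norm z < 1" for z
    using h1[OF that] by auto
  have holh: "h holomorphic_on ball 0 1"
    unfolding h_def using assms(1) by (intro holomorphic_intros holomorphic_chi2) auto
  have "H holomorphic_on ball 0 1"
    unfolding H_def by (intro holomorphic_intros holh) (use ne in auto)
  moreover have "Re (H z) \<ge> 0" if "norm z < 1" for z
    unfolding H_def using Re_cayley_pos[OF h1[OF that]] by (rule less_imp_le)
  moreover have "H 0 = 1"
    using chi2_0[of s t] assms(1) by (simp add: H_def h_def)
  ultimately obtain \<mu> where \<mu>: "circle_prob \<mu>"
    "\<And>z. norm z < 1 \<Longrightarrow> (\<integral>\<omega>. z * \<omega> / (1 - z * \<omega>) \<partial>\<mu>) = (H z - 1) / 2"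
    using herglotz_exists by blast
  have H_h: "(H z - 1) / 2 = h z / (1 - h z)" if "norm z < 1" for z
    using ne[OF that] by (simp add: H_def field_simps)
  show "\<exists>!\<mu>. circle_prob \<mu> \<and>
            (\<forall>z\<in>ball 0 1. (\<integral>\<omega>. z * \<omega> / (1 - z * \<omega>) \<partial>\<mu>)
                             = chi2 s t z * \<zeta> / (1 - chi2 s t z * \<zeta>))"
  proof (rule ex1I[of _ \<mu>])
    show ex: "circle_prob \<mu> \<and> (\<forall>z\<in>ball 0 1. (\<integral>\<omega>. z * \<omega> / (1 - z * \<omega>) \<partial>\<mu>)
                             = chi2 s t z * \<zeta> / (1 - chi2 s t z * \<zeta>))"
      using \<mu> H_h unfolding h_def by simp
    fix \<nu>
    assume \<nu>: "circle_prob \<nu> \<and> (\<forall>z\<in>ball 0 1. (\<integral>\<omega>. z * \<omega> / (1 - z * \<omega>) \<partial>\<nu>)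
                             = chi2 s t z * \<zeta> / (1 - chi2 s t z * \<zeta>))"
    show "\<nu> = \<mu>"
      using \<nu> ex by (intro circle_prob_eqI_moments circle_moments_eq) auto
  qed
  show "kernel2 s t \<zeta> = biane_kernel s \<zeta>" if "s = t"
    using that by (simp add: kernel2_def biane_kernel_def chi2_self)
qed

end
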